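(* Let $\bm A$, $\bm B$ be given, for $n,k\ge0$, by $$\bm A_{nk}=-(2n+1)^{1/2}(2k+1)^{1/2}\cdot\begin{cases}1&n>k\\ \frac{n+1}{2n+1}&n=k\\0&n<k\end{cases},\qquad \bm B_n=(2n+1)^{1/2}.$$ Define $\sigma(t,s)=\exp(a(s)-a(t))$ for any differentiable function $a$. Then the SSM $(a'(t)\bm A,\ a'(t)\bm B)$ is an OSSM with $$\omega(t,s)=\mathbb I(\sigma(t,s))\,a'(s)\,\sigma(t,s),\qquad p_n(t,s)=L_n(\sigma(t,s)).$$
   Context: $L_n$ denotes the Legendre polynomials rescaled to be orthonormal on $[0,1]$: $\int_0^1L_n(y)L_m(y)\,dy=\delta_{nm}$. $\mathbb I$ is the indicator function of $[0,1]$. An SSM $(\bm A(t),\bm B(t))$ is the system $x'(t)=\bm A(t)x(t)+\bm B(t)u(t)$, with scalar input $u$ and $N$-dimensional state $x(t)$ (matrix and vector indices run over $0,\dots,N-1$). It is an orthogonal SSM (OSSM) for basis $p_n(t,s)$ and measure $\omega(t,s)\ge0$ if, at all times $t$, $x_n(t)=\int_{-\infty}^tp_n(t,s)\omega(t,s)u(s)\,ds$ and $\int_{-\infty}^tp_n(t,s)p_m(t,s)\omega(t,s)\,ds=\delta_{nm}$.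
   Formalization: The differentiable function a, defined on the whole real line, is also assumed nondecreasing with a(s) → −∞ as s → −∞; the claim fails without this (constant a gives ω = 0), and both conditions are forced by ω ≥ 0 and orthonormality. Inputs u are continuous. *)

theory Defs
  imports
    "HOL-Analysis.Analysis"
    "HOL-Computational_Algebra.Polynomial"
begin

(* Rodrigues' formula; the normalisation is the classical one, legendre n at 1 equals 1. *)
definition legendre :: "nat \<Rightarrow> real poly" where
  "legendre n = smult (1 / (2 ^ n * fact n)) ((pderiv ^^ n) ([:-1, 0, 1:] ^ n))"

definition legendre01 :: "nat \<Rightarrow> real \<Rightarrow> real" where
  "legendre01 n y = sqrt (2 * real n + 1) * poly (legendre n) (2 * y - 1)"

(* An N-dimensional state is a family x n t of scalar functions, of which only the components
   n < N are meaningful; the same holds for the entries of A and B. *)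
definition ssm_solution ::
  "nat \<Rightarrow> (real \<Rightarrow> nat \<Rightarrow> nat \<Rightarrow> real) \<Rightarrow> (real \<Rightarrow> nat \<Rightarrow> real) \<Rightarrow>
    (real \<Rightarrow> real) \<Rightarrow> (nat \<Rightarrow> real \<Rightarrow> real) \<Rightarrow> bool" where
  "ssm_solution N A B u x \<longleftrightarrow>
    (\<forall>t. \<forall>n<N. (x n has_real_derivative ((\<Sum>k<N. A t n k * x k t) + B t n * u t)) (at t))"

(* The requirement that the state of the system be the coefficient integral is spelled out in
   both directions, since the differential equation alone does not fix an initial state:
   the integrals solve the equation whenever they converge (third clause), and a system which
   is at rest until its input is switched on at t0 has no other state (fourth clause).
   Convergence is stated explicitly because divergent integrals have the value 0. *)
definition is_ossm ::
  "nat \<Rightarrow> (real \<Rightarrow> nat \<Rightarrow> nat \<Rightarrow> real) \<Rightarrow> (real \<Rightarrow> nat \<Rightarrow> real) \<Rightarrow>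
    (nat \<Rightarrow> real \<Rightarrow> real \<Rightarrow> real) \<Rightarrow> (real \<Rightarrow> real \<Rightarrow> real) \<Rightarrow> bool" where
  "is_ossm N A B p \<omega> \<longleftrightarrow>
    (\<forall>t s. 0 \<le> \<omega> t s) \<and>
    (\<forall>t. \<forall>n<N. \<forall>m<N.
      set_integrable lborel {..t} (\<lambda>s. p n t s * p m t s * \<omega> t s) \<and>
      (LINT s:{..t}|lborel. p n t s * p m t s * \<omega> t s) = (if n = m then 1 else 0)) \<and>
    (\<forall>u. continuous_on UNIV u \<longrightarrow>
      (\<forall>t. \<forall>n<N. set_integrable lborel {..t} (\<lambda>s. p n t s * \<omega> t s * u s)) \<longrightarrow>
      ssm_solution N A B u (\<lambda>n t. LINT s:{..t}|lborel. p n t s * \<omega> t s * u s)) \<and>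
    (\<forall>u t0. continuous_on UNIV u \<longrightarrow> (\<forall>t\<le>t0. u t = 0) \<longrightarrow>
      (\<forall>t. \<forall>n<N. set_integrable lborel {..t} (\<lambda>s. p n t s * \<omega> t s * u s)) \<and>
      (\<forall>x. ssm_solution N A B u x \<longrightarrow> (\<forall>t\<le>t0. \<forall>n<N. x n t = 0) \<longrightarrow>
        (\<forall>t. \<forall>n<N. x n t = (LINT s:{..t}|lborel. p n t s * \<omega> t s * u s))))"

definition legs_A :: "nat \<Rightarrow> nat \<Rightarrow> real" where
  "legs_A n k = - (sqrt (2 * real n + 1) * sqrt (2 * real k + 1) *
    (if n > k then 1 else if n = k then (real n + 1) / (2 * real n + 1) else 0))"

definition legs_B :: "nat \<Rightarrow> real" where
  "legs_B n = sqrt (2 * real n + 1)"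

definition warp :: "(real \<Rightarrow> real) \<Rightarrow> real \<Rightarrow> real \<Rightarrow> real" where
  "warp a t s = exp (a s - a t)"

end

theory Submission
  imports Defs
begin

text \<open>
  The Legendre polynomials \<open>S\<^sub>n\<close> shifted to \<open>[0,1]\<close>, normalised by \<open>S\<^sub>n(1) = 1\<close>, satisfy
  \<open>(y S\<^sub>n)' = (n + 1) S\<^sub>n + (\<Sum>k<n. (2k + 1) S\<^sub>k)\<close>; up to the scaling by \<open>sqrt (2n + 1)\<close> the
  right-hand side is given by row \<open>n\<close> of \<open>-A\<close>. The state is a moment
  \<open>\<integral> q(\<sigma>(t,s)) a'(s) \<sigma>(t,s) u(s) ds\<close> with \<open>q = S\<^sub>n\<close>, and since \<open>\<partial>\<sigma>/\<partial>t = -a'(t) \<sigma>\<close>, its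
  derivative is \<open>a'(t)\<close> times \<open>q(1) u(t)\<close> minus the moment of \<open>(y q)'\<close>. For \<open>u = 1\<close> the substitution
  \<open>y = \<sigma>(t,s)\<close> turns moments into integrals over \<open>[0,1]\<close>, where the same recurrence and integration by
  parts give orthogonality. Uniqueness follows because \<open>A\<close> is lower triangular.
\<close>

section \<open>Derivative recurrences for the Legendre polynomials\<close>

text \<open>Leibniz rule of order \<open>Suc n\<close>; only two terms survive, because the second
  derivative of X is zero.\<close>

lemma higher_pderiv_X_mult:
  "(pderiv ^^ Suc n) ([:0, 1:] * p) =
    [:0, 1:] * (pderiv ^^ Suc n) p + smult (of_nat (Suc n)) ((pderiv ^^ n) p)"
  for p :: "'a::idom poly"
proof (induction n)
  case 0
  show ?case by (simp add: pderiv_mult pderiv_pCons)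
next
  case (Suc n)
  have "(pderiv ^^ Suc (Suc n)) ([:0, 1:] * p) =
      pderiv ([:0, 1:] * (pderiv ^^ Suc n) p + smult (of_nat (Suc n)) ((pderiv ^^ n) p))"
    using Suc by simp
  also have "\<dots> = [:0, 1:] * (pderiv ^^ Suc (Suc n)) p +
      smult (of_nat (Suc (Suc n))) ((pderiv ^^ Suc n) p)"
    by (simp add: pderiv_mult pderiv_add pderiv_smult pderiv_pCons smult_add_left numeral_poly)
  finally show ?case .
qed

text \<open>One derivative in Rodrigues' formula is moved inside, where it turns
  \<open>W (Suc n)\<close>, with \<open>W k\<close> the power (X^2 - 1)^k, into a multiple of X
  times \<open>W n\<close>; the Leibniz rule for the factor X does the rest.\<close>

lemma pderiv_legendre_Suc:
  "pderiv (legendre (Suc n)) = [:0, 1:] * pderiv (legendre n) + smult (real n + 1) (legendre n)"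
proof -
  define W where "W = ([:-1, 0, 1:] :: real poly) ^ n"
  have "pderiv (legendre (Suc n)) =
      smult (1 / (2 ^ Suc n * fact (Suc n))) ((pderiv ^^ Suc n) (pderiv ([:-1, 0, 1:] ^ Suc n)))"
    unfolding legendre_def pderiv_smult by (simp only: funpow_Suc_right funpow.simps o_apply funpow_swap1)
  also have "pderiv ([:-1, 0, 1:] ^ Suc n) = smult (2 * (real n + 1)) ([:0, 1:] * W)"
    unfolding pderiv_power_Suc W_def[symmetric] by (simp add: pderiv_pCons algebra_simps smult_add_left)
  also have "(pderiv ^^ Suc n) \<dots> = smult (2 * (real n + 1))
      ([:0, 1:] * (pderiv ^^ Suc n) W + smult (real n + 1) ((pderiv ^^ n) W))"
    unfolding higher_pderiv_smult higher_pderiv_X_mult by (simp add: add.commute)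
  also have "smult (1 / (2 ^ Suc n * fact (Suc n))) \<dots> = smult (1 / (2 ^ n * fact n))
      ([:0, 1:] * (pderiv ^^ Suc n) W + smult (real n + 1) ((pderiv ^^ n) W))"
    by (simp only: smult_smult, rule arg_cong2[where f=smult]) (simp_all add: divide_simps)
  also have "\<dots> = [:0, 1:] * pderiv (legendre n) + smult (real n + 1) (legendre n)"
    by (simp add: legendre_def W_def pderiv_smult smult_add_right mult.commute)
  finally show ?thesis .
qed

text \<open>Here two derivatives are moved inside Rodrigues' formula. They leave a combination of
  two lower powers of X^2 - 1, each of which is again in Rodrigues form.\<close>

lemma pderiv_legendre_Suc_Suc:
  "pderiv (legendre (Suc (Suc n))) = smult (2 * real n + 3) (legendre (Suc n)) + pderiv (legendre n)"
proof -
  define W where "W = (\<lambda>k. ([:-1, 0, 1:] :: real poly) ^ k)"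
  have W_Suc: "pderiv (W (Suc k)) = smult (2 * (real k + 1)) ([:0, 1:] * W k)" for k
    unfolding W_def pderiv_power_Suc by (simp add: pderiv_pCons algebra_simps smult_add_left)
  have "pderiv (pderiv (W (Suc (Suc n)))) = smult (2 * (real n + 2))
      (smult (2 * (real n + 1)) ([:0, 1:] * [:0, 1:] * W n) + W (Suc n))"
    unfolding W_Suc by (simp add: pderiv_smult pderiv_mult W_Suc pderiv_pCons smult_add_right add.commute)
  \<comment> \<open>X^2 is split as (X^2 - 1) + 1, which removes the explicit X.\<close>
  also have "[:0, 1:] * [:0, 1:] * W n = W (Suc n) + W n"
    by (simp add: W_def algebra_simps)
  also have "smult (2 * (real n + 1)) (W (Suc n) + W n) + W (Suc n) =
      smult (2 * real n + 3) (W (Suc n)) + smult (2 * (real n + 1)) (W n)"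
    using smult_add_left[of "2 * (real n + 1)" 1 "W (Suc n)"]
    by (simp add: smult_add_right algebra_simps)
  finally have W2: "pderiv (pderiv (W (Suc (Suc n)))) = smult (2 * (real n + 2)) \<dots>" .
  \<comment> \<open>The factor 2(k + 1) from differentiating a power of X^2 - 1 is exactly what
    lowers the index of the Rodrigues normalisation by one.\<close>
  have scale: "1 / (2 ^ Suc (Suc n) * fact (Suc (Suc n))) * (2 * (real n + 2)) =
      1 / (2 ^ Suc n * fact (Suc n))"
    by (simp add: divide_simps)
  have scale': "1 / (2 ^ Suc n * fact (Suc n)) * (2 * (real n + 1)) = 1 / (2 ^ n * fact n)"
    by (simp add: divide_simps)
  have "pderiv (legendre (Suc (Suc n))) = smult (1 / (2 ^ Suc (Suc n) * fact (Suc (Suc n))))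
      ((pderiv ^^ Suc n) (pderiv (pderiv (W (Suc (Suc n))))))"
    unfolding legendre_def pderiv_smult W_def
    by (simp only: funpow_Suc_right funpow.simps o_apply funpow_swap1)
  also have "\<dots> = smult (1 / (2 ^ Suc n * fact (Suc n)))
      (smult (2 * real n + 3) ((pderiv ^^ Suc n) (W (Suc n)))
        + smult (2 * (real n + 1)) ((pderiv ^^ Suc n) (W n)))"
    unfolding W2 higher_pderiv_smult higher_pderiv_add smult_smult scale ..
  also have "\<dots> = smult (2 * real n + 3) (legendre (Suc n)) + pderiv (legendre n)"
    using scale'
    by (simp add: legendre_def W_def pderiv_smult smult_add_right mult.commute del: fact_Suc power_Suc)
  finally show ?thesis .
qed

lemma legendre_0: "legendre 0 = 1"
  by (simp add: legendre_def)

text \<open>The preceding recurrence alone would reach every second index only. Adding two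
  consecutive derivatives collects all indices, one new term per induction step.\<close>

lemma pderiv_legendre_sum:
  "pderiv (legendre (Suc n)) + pderiv (legendre n) =
    (\<Sum>k<Suc n. smult (2 * real k + 1) (legendre k))"
proof (induction n)
  case 0
  show ?case using pderiv_legendre_Suc[of 0] by (simp add: legendre_0 pderiv_1)
next
  case (Suc n)
  then show ?case
    by (simp add: pderiv_legendre_Suc_Suc algebra_simps)
qed

text \<open>The derivative of \<open>legendre (Suc (Suc n))\<close> is eliminated between the two
  recurrences above.\<close>

lemma X_mult_pderiv_legendre_Suc:
  "[:0, 1:] * pderiv (legendre (Suc n)) =
    smult (real n + 1) (legendre (Suc n)) + pderiv (legendre n)"
proof -
  have "[:0, 1:] * pderiv (legendre (Suc n)) + smult (real (Suc n) + 1) (legendre (Suc n)) =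
      smult (2 * real n + 3) (legendre (Suc n)) + pderiv (legendre n)"
    using pderiv_legendre_Suc[of "Suc n"] pderiv_legendre_Suc_Suc[of n] by simp
  then have "[:0, 1:] * pderiv (legendre (Suc n)) = smult (2 * real n + 3) (legendre (Suc n))
      - smult (real (Suc n) + 1) (legendre (Suc n)) + pderiv (legendre n)"
    by (simp add: algebra_simps)
  then show ?thesis
    by (simp add: smult_diff_left[symmetric] add.commute)
qed

text \<open>The factor 1 + X is the one needed on the unit interval: for X = 2y - 1 it equals 2y,
  and its 2 is absorbed by the chain rule.\<close>

lemma one_plus_X_mult_pderiv_legendre:
  "[:1, 1:] * pderiv (legendre n) =
    smult (real n) (legendre n) + (\<Sum>k<n. smult (2 * real k + 1) (legendre k))"
proof (cases n)
  case 0
  then show ?thesis by (simp add: legendre_0 pderiv_1)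
next
  case (Suc m)
  have "[:1, 1:] * pderiv (legendre n) = [:0, 1:] * pderiv (legendre n) + pderiv (legendre n)"
    by simp
  then show ?thesis
    using X_mult_pderiv_legendre_Suc[of m] pderiv_legendre_sum[of m] Suc
    by (simp add: algebra_simps del: mult_pCons_left sum.lessThan_Suc)
qed

text \<open>Two expressions for the derivative of \<open>legendre (Suc n)\<close> are compared at 1;
  the derivative of \<open>legendre n\<close> cancels, leaving the value itself.\<close>

lemma legendre_at_1: "poly (legendre n) 1 = 1"
proof (induction n)
  case 0
  show ?case by (simp add: legendre_0)
next
  case (Suc n)
  have "poly (pderiv (legendre (Suc n))) 1 = poly (pderiv (legendre n)) 1 + (real n + 1)"
    using Suc by (simp add: pderiv_legendre_Suc)
  moreover have "poly ([:0, 1:] * pderiv (legendre (Suc n))) 1 =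
      (real n + 1) * poly (legendre (Suc n)) 1 + poly (pderiv (legendre n)) 1"
    unfolding X_mult_pderiv_legendre_Suc by simp
  ultimately show ?case by simp
qed

section \<open>Shifted Legendre polynomials and their orthogonality\<close>

definition shifted_legendre :: "nat \<Rightarrow> real poly" where
  "shifted_legendre n = pcompose (legendre n) [:-1, 2:]"

lemma legendre01_conv: "legendre01 n y = sqrt (2 * real n + 1) * poly (shifted_legendre n) y"
  by (simp add: legendre01_def shifted_legendre_def poly_pcompose algebra_simps)

lemma shifted_legendre_at_1: "poly (shifted_legendre n) 1 = 1"
  by (simp add: shifted_legendre_def poly_pcompose legendre_at_1)

lemma pderiv_X_mult_shifted_legendre:
  "pderiv ([:0, 1:] * shifted_legendre n) = smult (real n + 1) (shifted_legendre n) +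
    (\<Sum>k<n. smult (2 * real k + 1) (shifted_legendre k))"
proof -
  have "[:0, 1:] * pderiv (shifted_legendre n) = pcompose ([:1, 1:] * pderiv (legendre n)) [:-1, 2:]"
    by (simp add: shifted_legendre_def pderiv_pcompose pcompose_mult pcompose_add pcompose_pCons
        pderiv_pCons algebra_simps flip: smult_add_left)
  also have "\<dots> = smult (real n) (shifted_legendre n) +
      (\<Sum>k<n. smult (2 * real k + 1) (shifted_legendre k))"
    unfolding one_plus_X_mult_pderiv_legendre
    by (simp add: shifted_legendre_def pcompose_add pcompose_smult pcompose_sum)
  finally show ?thesis
    by (simp add: pderiv_mult pderiv_pCons smult_add_left del: mult_pCons_left)
qed

text \<open>
  Applying \<open>J\<close> to \<open>(y S\<^sub>n S\<^sub>m)' = (y S\<^sub>n)' S\<^sub>m + S\<^sub>n (y S\<^sub>m)' - S\<^sub>n S\<^sub>m\<close> and expanding by the recurrence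
  gives \<open>(n + m + 1) J(S\<^sub>n S\<^sub>m)\<close> in terms of the values of smaller index.
\<close>

lemma shifted_legendre_orthogonal:
  assumes add: "\<And>p q. J (p + q) = J p + J q"
    and smult: "\<And>c p. J (smult c p) = c * J p"
    and J_pderiv: "\<And>q. J (pderiv q) = poly q 1 - poly q 0"
  shows "J (shifted_legendre n * shifted_legendre m) = (if n = m then 1 / (2 * real n + 1) else (0::real))"
proof (induction "n + m" arbitrary: n m rule: less_induct)
  case less
  define S where "S = shifted_legendre"
  define M where "M = (\<lambda>i j. J (S i * S j))"
  have IH: "M i j = (if i = j then 1 / (2 * real i + 1) else 0)" if "i + j < n + m" for i j
    unfolding M_def S_def using less that by simp
  have J_sum: "J (\<Sum>k<l. smult (2 * real k + 1) (f k)) = (\<Sum>k<l. (2 * real k + 1) * J (f k))" for f l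
    using smult[of 0 0] by (induction l) (simp_all add: add smult)
  have deriv: "pderiv ([:0, 1:] * S i) = smult (real i + 1) (S i) + (\<Sum>k<i. smult (2 * real k + 1) (S k))" for i
    unfolding S_def by (rule pderiv_X_mult_shifted_legendre)
  have "pderiv ([:0, 1:] * S n * S m) + S n * S m =
      pderiv ([:0, 1:] * S n) * S m + pderiv ([:0, 1:] * S m) * S n"
    by (simp add: pderiv_mult pderiv_pCons algebra_simps)
  also have "\<dots> = smult (real n + 1) (S n * S m) + (\<Sum>k<n. smult (2 * real k + 1) (S k * S m)) +
      (smult (real m + 1) (S m * S n) + (\<Sum>k<m. smult (2 * real k + 1) (S k * S n)))"
    unfolding deriv by (simp add: distrib_right sum_distrib_right)
  finally have "J (pderiv ([:0, 1:] * S n * S m)) + M n m =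
      (real n + 1) * M n m + (\<Sum>k<n. (2 * real k + 1) * M k m) +
      ((real m + 1) * M m n + (\<Sum>k<m. (2 * real k + 1) * M k n))"
    unfolding M_def add[symmetric] by (simp only: add smult J_sum)
  moreover have "M m n = M n m"
    by (simp add: M_def mult.commute)
  moreover have "J (pderiv ([:0, 1:] * S n * S m)) = 1"
    by (subst J_pderiv) (simp add: S_def shifted_legendre_at_1)
  moreover have "(\<Sum>k<n. (2 * real k + 1) * M k m) = (\<Sum>k<n. if k = m then 1 else 0)"
    by (intro sum.cong) (auto simp: IH)
  moreover have "(\<Sum>k<m. (2 * real k + 1) * M k n) = (\<Sum>k<m. if k = n then 1 else 0)"
    by (intro sum.cong) (auto simp: IH)
  \<comment> \<open>The boundary term is 1. If \<open>n\<close> and \<open>m\<close> differ, exactly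
    one of the two sums contains the index where its summand is 1, and it cancels that boundary
    term; if they agree, both sums vanish.\<close>
  ultimately have "(real n + real m + 1) * M n m = (if n = m then 1 else 0)"
    by (auto simp: algebra_simps split: if_splits)
  moreover have "real n + real m + 1 \<noteq> 0"
    by linarith
  ultimately have "M n m = (if n = m then 1 / (2 * real n + 1) else 0)"
    by (auto simp: divide_simps mult.commute)
  then show ?case
    by (simp add: M_def S_def)
qed


section \<open>Rows of the matrix, and facts on real functions\<close>

text \<open>Puts row \<open>n\<close> in the shape of the recurrence for
  \<open>shifted_legendre\<close>: on the diagonal the two square roots cancel the
  denominator.\<close>

lemma legs_A_sum:
  assumes "n < N"
  shows "(\<Sum>k<N. legs_A n k * x k) =
    - ((real n + 1) * x n + sqrt (2 * real n + 1) * (\<Sum>k<n. sqrt (2 * real k + 1) * x k))"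
proof -
  have "(\<Sum>k<N. legs_A n k * x k) = (\<Sum>k\<in>{..n}. legs_A n k * x k)"
    using assms by (intro sum.mono_neutral_right) (auto simp: legs_A_def)
  also have "\<dots> = (\<Sum>k<n. legs_A n k * x k) + legs_A n n * x n"
    by (simp flip: lessThan_Suc_atMost)
  also have "(\<Sum>k<n. legs_A n k * x k) =
      - (sqrt (2 * real n + 1) * (\<Sum>k<n. sqrt (2 * real k + 1) * x k))"
    unfolding sum_distrib_left sum_negf[symmetric]
    by (intro sum.cong) (auto simp: legs_A_def)
  also have "legs_A n n = - (real n + 1)"
    by (simp add: legs_A_def)
  finally show ?thesis
    by (simp add: algebra_simps)
qed

text \<open>A derivative is the pointwise limit of difference quotients of a continuous function, so
  it is measurable even where it is discontinuous.\<close>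

lemma borel_measurable_deriv:
  fixes f :: "real \<Rightarrow> real"
  assumes "\<And>x. f differentiable at x"
  shows "deriv f \<in> borel_measurable borel"
proof (rule borel_measurable_LIMSEQ_real)
  have "continuous_on UNIV f"
    using assms by (simp add: continuous_on_eq_continuous_at differentiable_imp_continuous_within)
  then have [measurable]: "f \<in> borel_measurable borel"
    by (rule borel_measurable_continuous_onI)
  show "(\<lambda>x. (f (x + 1 / real (Suc n)) - f x) / (1 / real (Suc n))) \<in> borel_measurable borel" for n
    by measurable
  show "(\<lambda>n. (f (x + 1 / real (Suc n)) - f x) / (1 / real (Suc n))) \<longlonglongrightarrow> deriv f x" for x
  proof -
    have "((\<lambda>h. (f (x + h) - f x) / h) \<longlongrightarrow> deriv f x) (at 0)"
      using assms[of x] by (simp add: DERIV_def DERIV_deriv_iff_real_differentiable[symmetric])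
    moreover have "filterlim (\<lambda>n. 1 / real (Suc n)) (at 0) sequentially"
      using LIMSEQ_Suc[OF lim_1_over_n[where 'a=real]]
      by (auto simp: filterlim_at intro: tendsto_eq_intros)
    ultimately show ?thesis
      by (rule filterlim_compose)
  qed
qed

lemma poly_bounded_unit_interval:
  fixes q :: "real poly"
  obtains B where "\<And>y. 0 \<le> y \<Longrightarrow> y \<le> 1 \<Longrightarrow> \<bar>poly q y\<bar> \<le> B"
proof -
  have "compact (poly q ` {0..1})"
    by (intro compact_continuous_image continuous_intros compact_Icc)
  then have "bounded (poly q ` {0..1})"
    by (rule compact_imp_bounded)
  then obtain B where "\<forall>y\<in>{0..1}. \<bar>poly q y\<bar> \<le> B"
    unfolding bounded_iff by auto
  then show ?thesis
    using that[of B] by simp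
qed

section \<open>The time warp and its density\<close>

text \<open>Monotonicity keeps \<open>warp a t s\<close> in (0, 1] for \<open>s \<le> t\<close> and
  makes the weight nonnegative; the limit of \<open>a\<close> in the past makes the warp start from
  0, so that the whole unit interval is covered.\<close>

locale time_warp =
  fixes a :: "real \<Rightarrow> real"
  assumes differentiable: "a differentiable_on UNIV"
    and mono: "mono a"
    and past: "filterlim a at_bot at_bot"
begin

text \<open>The derivative of \<open>warp a t\<close>, that is, the weight without its indicator,
  which is 1 on the range of integration \<open>{..t}\<close>.\<close>

definition warp_density :: "real \<Rightarrow> real \<Rightarrow> real" where
  "warp_density t s = deriv a s * warp a t s"

lemma has_deriv: "(a has_real_derivative deriv a t) (at t)"
  using differentiable
  by (simp add: differentiable_on_def DERIV_deriv_iff_real_differentiable)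

lemma continuous_a: "continuous_on S a"
  by (rule DERIV_continuous_on[OF has_field_derivative_at_within[OF has_deriv]])

lemma borel_a [measurable]: "a \<in> borel_measurable borel"
  using continuous_a by (rule borel_measurable_continuous_onI)

lemma borel_deriv_a [measurable]: "deriv a \<in> borel_measurable borel"
  using has_deriv by (intro borel_measurable_deriv) (auto simp: real_differentiable_def)

lemma borel_warp [measurable]: "warp a t \<in> borel_measurable borel"
  unfolding warp_def by measurable

lemma borel_warp_density [measurable]: "warp_density t \<in> borel_measurable borel"
  unfolding warp_density_def by measurable

lemma deriv_a_nonneg: "0 \<le> deriv a t"
  using mono_on_imp_deriv_nonneg[of UNIV a, OF _ has_deriv] mono by simp

lemma warp_pos: "0 < warp a t s"
  by (simp add: warp_def)

lemma warp_le_1: "s \<le> t \<Longrightarrow> warp a t s \<le> 1"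
  using mono by (simp add: warp_def monoD)

lemma warp_refl [simp]: "warp a t t = 1"
  by (simp add: warp_def)

lemma warp_tendsto_0: "(warp a t \<longlongrightarrow> 0) at_bot"
proof -
  have "((\<lambda>s. exp (a s) / exp (a t)) \<longlongrightarrow> 0 / exp (a t)) at_bot"
    by (intro tendsto_divide tendsto_const filterlim_compose[OF exp_at_bot past]) simp
  then show ?thesis
    by (simp add: warp_def[abs_def] exp_diff)
qed

lemma warp_density_nonneg: "0 \<le> warp_density t s"
  using deriv_a_nonneg warp_pos[of t s] by (simp add: warp_density_def)

lemma warp_has_deriv: "(warp a t has_real_derivative warp_density t s) (at s)"
  unfolding warp_def warp_density_def by (auto intro!: derivative_eq_intros has_deriv)

text \<open>The density is nonnegative with antiderivative \<open>warp a t\<close>, so its integrals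
  over growing intervals increase to the finite total mass 1.\<close>

lemma integrable_warp_density: "set_integrable lborel {..t} (warp_density t)"
  unfolding set_integrable_def
proof (rule integrable_monotone_convergence)
  let ?f = "\<lambda>i s. warp_density t s * indicator {t - real i..t} s"
  show "integrable lborel (?f i)" for i
    by (rule integrable_FTC_Icc_nonneg[OF _ warp_has_deriv]) (simp_all add: warp_density_nonneg)
  show "AE s in lborel. mono (\<lambda>i. ?f i s)"
    by (auto simp: mono_def warp_density_nonneg indicator_def)
  show "AE s in lborel. (\<lambda>i. ?f i s) \<longlonglongrightarrow> indicat_real {..t} s *\<^sub>R warp_density t s"
  proof (rule AE_I2)
    fix s
    have "\<forall>\<^sub>F i in sequentially. t - s \<le> real i"
      using filterlim_real_sequentially by (simp add: filterlim_at_top)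
    then have "\<forall>\<^sub>F i in sequentially. ?f i s = indicat_real {..t} s *\<^sub>R warp_density t s"
      by eventually_elim (auto simp: indicator_def)
    then show "(\<lambda>i. ?f i s) \<longlonglongrightarrow> indicat_real {..t} s *\<^sub>R warp_density t s"
      by (rule tendsto_eventually)
  qed
  have "filterlim (\<lambda>i. t - real i) at_bot sequentially"
    by real_asymp
  then have "(\<lambda>i. warp a t t - warp a t (t - real i)) \<longlonglongrightarrow> warp a t t - 0"
    by (intro tendsto_diff tendsto_const filterlim_compose[OF warp_tendsto_0])
  moreover have "(\<integral>s. ?f i s \<partial>lborel) = warp a t t - warp a t (t - real i)" for i
    by (rule integral_FTC_Icc_nonneg[OF _ warp_has_deriv]) (simp_all add: warp_density_nonneg)
  ultimately show "(\<lambda>i. \<integral>s. ?f i s \<partial>lborel) \<longlonglongrightarrow> warp a t t - 0"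
    by simp
qed simp

lemma integrable_poly_warp_mult:
  assumes f: "set_integrable lborel {..t} f"
  shows "set_integrable lborel {..t} (\<lambda>s. poly q (warp a t s) * f s)"
proof -
  obtain B where B: "\<bar>poly q y\<bar> \<le> B" if "0 \<le> y" "y \<le> 1" for y
    using poly_bounded_unit_interval[of q] by blast
  have "B \<ge> 0"
    using B[of 0] by simp
  have [measurable]: "poly q \<in> borel_measurable borel"
    by (intro borel_measurable_continuous_onI continuous_intros)
  show ?thesis
  proof (rule set_integrable_bound)
    show "set_integrable lborel {..t} (\<lambda>s. B * f s)"
      using f by simp
    \<comment> \<open>Nothing is known of \<open>f\<close> outside \<open>{..t}\<close>, so
      measurability is available only for its product with the indicator.\<close>
    have [measurable]: "(\<lambda>s. indicat_real {..t} s *\<^sub>R f s) \<in> borel_measurable borel"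
      using f by (auto simp: set_integrable_def dest: borel_measurable_integrable)
    have "(\<lambda>s. poly q (warp a t s) * (indicat_real {..t} s *\<^sub>R f s)) \<in> borel_measurable lborel"
      by measurable
    then show "set_borel_measurable lborel {..t} (\<lambda>s. poly q (warp a t s) * f s)"
      by (simp add: set_borel_measurable_def mult.left_commute)
    show "AE s in lborel. s \<in> {..t} \<longrightarrow> norm (poly q (warp a t s) * f s) \<le> norm (B * f s)"
      using warp_le_1 warp_pos B \<open>B \<ge> 0\<close>
      by (auto simp: abs_mult less_imp_le intro!: mult_right_mono)
  qed
qed

text \<open>The fundamental theorem of calculus for nonnegative measurable derivatives applies,
  since \<open>a\<close> is monotone.\<close>

lemma integrable_deriv_a: "set_integrable lborel {r..s} (deriv a)"
  and integral_deriv_a: "r \<le> s \<Longrightarrow> (LINT x:{r..s}|lborel. deriv a x) = a s - a r"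
proof -
  have *: "integrable lborel (\<lambda>x. deriv a x * indicator {r..s} x) \<and>
      (\<integral>x. deriv a x * indicator {r..s} x \<partial>lborel) = a s - a r" if "r \<le> s"
    using integrable_FTC_Icc_nonneg[OF _ has_deriv _ that] integral_FTC_Icc_nonneg[OF _ has_deriv _ that]
    by (simp add: deriv_a_nonneg)
  then show "r \<le> s \<Longrightarrow> (LINT x:{r..s}|lborel. deriv a x) = a s - a r"
    by (simp add: set_lebesgue_integral_def mult.commute)
  show "set_integrable lborel {r..s} (deriv a)"
    using * by (cases "r \<le> s") (simp_all add: set_integrable_def mult.commute)
qed

section \<open>Differentiating running integrals\<close>

text \<open>As \<open>deriv a\<close> is nonnegative, the integrand between \<open>r\<close> and
  \<open>s\<close> lies between \<open>c - e\<close> and \<open>c + e\<close> times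
  \<open>deriv a\<close>, whose integral is \<open>a s - a r\<close>.\<close>

lemma running_integral_increment:
  assumes int: "set_integrable lborel {..s} (\<lambda>x. g x * deriv a x)"
    and "r \<le> s" and g: "\<And>x. r \<le> x \<Longrightarrow> x \<le> s \<Longrightarrow> \<bar>g x - c\<bar> \<le> e"
  shows "\<bar>(LINT x:{..s}|lborel. g x * deriv a x) - (LINT x:{..r}|lborel. g x * deriv a x)
    - c * (a s - a r)\<bar> \<le> e * (a s - a r)"
proof -
  let ?f = "\<lambda>x. g x * deriv a x"
  let ?I = "LINT x:{r<..s}|lborel. ?f x"
  have split: "{..s} = {..r} \<union> {r<..s}"
    using \<open>r \<le> s\<close> by auto
  have f: "set_integrable lborel {..r} ?f" "set_integrable lborel {r<..s} ?f"
    using \<open>r \<le> s\<close> by (auto intro: set_integrable_subset[OF int])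
  have "(LINT x:{..s}|lborel. ?f x) = (LINT x:{..r}|lborel. ?f x) + ?I"
    unfolding split by (rule set_integral_Un) (use f in auto)
  moreover have a: "set_integrable lborel {r<..s} (deriv a)"
    by (rule set_integrable_subset[OF integrable_deriv_a[of r s]]) auto
  have "(LINT x:{r<..s}|lborel. deriv a x) = (LINT x:{r..s}|lborel. deriv a x)"
    by (rule set_integral_discrete_difference[where X="{r}"]) auto
  then have Ia: "(LINT x:{r<..s}|lborel. k * deriv a x) = k * (a s - a r)" for k
    using \<open>r \<le> s\<close> by (simp add: integral_deriv_a)
  have bounds: "g x * deriv a x \<le> (c + e) * deriv a x" "(c - e) * deriv a x \<le> g x * deriv a x"
    if "x \<in> {r<..s}" for x
    using g[of x] that by (auto simp: abs_le_iff intro!: mult_right_mono deriv_a_nonneg)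
  have "?I \<le> (LINT x:{r<..s}|lborel. (c + e) * deriv a x)"
    by (intro set_integral_mono f set_integrable_mult_right a bounds)
  moreover have "(LINT x:{r<..s}|lborel. (c - e) * deriv a x) \<le> ?I"
    by (intro set_integral_mono f set_integrable_mult_right a bounds)
  ultimately show ?thesis
    unfolding Ia by (simp add: abs_le_iff algebra_simps)
qed

text \<open>
  The derivative of \<open>a\<close> need not be continuous, so the fundamental theorem of calculus does not
  apply to the integrand. Instead, the increments of the integral are compared with those of \<open>a\<close>.
\<close>

lemma running_integral_has_derivative:
  assumes int: "\<And>t. set_integrable lborel {..t} (\<lambda>s. g s * deriv a s)"
    and g: "isCont g t"
  shows "((\<lambda>t. LINT s:{..t}|lborel. g s * deriv a s) has_real_derivative g t * deriv a t) (at t)"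
proof -
  define G where "G = (\<lambda>t. LINT s:{..t}|lborel. g s * deriv a s)"
  \<comment> \<open>The difference quotient of \<open>G\<close> with respect to \<open>a\<close>; it
    factors the ordinary quotient of \<open>G\<close> through that of \<open>a\<close>. The default
    \<open>g t\<close> is the limit to be reached.\<close>
  define k where "k = (\<lambda>s. if a s = a t then g t else (G s - G t) / (a s - a t))"
  have near: "\<exists>d>0. \<forall>s. \<bar>s - t\<bar> < d \<longrightarrow> \<bar>G s - G t - g t * (a s - a t)\<bar> \<le> e * \<bar>a s - a t\<bar>"
    if "e > 0" for e
  proof -
    obtain d where "d > 0" and d: "\<And>x. \<bar>x - t\<bar> < d \<Longrightarrow> \<bar>g x - g t\<bar> < e"
      using g \<open>e > 0\<close> unfolding continuous_at_real_range by (auto simp: real_norm_def)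
    have "\<bar>G s - G t - g t * (a s - a t)\<bar> \<le> e * \<bar>a s - a t\<bar>" if s: "\<bar>s - t\<bar> < d" for s
    proof (cases "t \<le> s")
      case True
      have "\<bar>g x - g t\<bar> \<le> e" if "t \<le> x" "x \<le> s" for x
        using d[of x] that s by auto
      then show ?thesis
        using running_integral_increment[OF int True, of "g t" e] monoD[OF mono True]
        by (simp add: G_def)
    next
      case False
      then have le: "s \<le> t"
        by simp
      have "\<bar>g x - g t\<bar> \<le> e" if "s \<le> x" "x \<le> t" for x
        using d[of x] that s by auto
      then have "\<bar>G t - G s - g t * (a t - a s)\<bar> \<le> e * (a t - a s)"
        using running_integral_increment[OF int le, of "g t" e] by (simp add: G_def)
      moreover have "G s - G t - g t * (a s - a t) = - (G t - G s - g t * (a t - a s))"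
        by (simp add: algebra_simps)
      ultimately show ?thesis
        using monoD[OF mono le] by (simp only: abs_minus_cancel) simp
    qed
    with \<open>d > 0\<close> show ?thesis
      by blast
  qed
  \<comment> \<open>Where \<open>a s = a t\<close>, the estimate \<open>near\<close> forces
    \<open>G s = G t\<close>, so both sides are 0 whatever the default value in
    \<open>k\<close>.\<close>
  have G_eq: "\<forall>\<^sub>F s in at t. k s * ((a s - a t) / (s - t)) = (G s - G t) / (s - t)"
  proof -
    obtain d where "d > 0" and d: "\<And>s. \<bar>s - t\<bar> < d \<Longrightarrow>
        \<bar>G s - G t - g t * (a s - a t)\<bar> \<le> 1 * \<bar>a s - a t\<bar>"
      using near[of 1] by auto
    have "k s * ((a s - a t) / (s - t)) = (G s - G t) / (s - t)" if "\<bar>s - t\<bar> < d" for s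
      using d[OF that] by (auto simp: k_def)
    then show ?thesis
      using \<open>d > 0\<close> unfolding eventually_at dist_real_def by blast
  qed
  have "(k \<longlongrightarrow> g t) (at t)"
    unfolding LIM_eq
  proof (intro allI impI)
    fix e :: real
    assume "e > 0"
    then obtain d where "d > 0" and d: "\<And>s. \<bar>s - t\<bar> < d \<Longrightarrow>
        \<bar>G s - G t - g t * (a s - a t)\<bar> \<le> e / 2 * \<bar>a s - a t\<bar>"
      using near[of "e / 2"] by auto
    have "\<bar>k s - g t\<bar> < e" if "\<bar>s - t\<bar> < d" for s
    proof (cases "a s = a t")
      case True
      then show ?thesis
        using \<open>e > 0\<close> by (simp add: k_def)
    next
      case False
      then have "k s - g t = (G s - G t - g t * (a s - a t)) / (a s - a t)"
        by (simp add: k_def field_simps)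
      then have "\<bar>k s - g t\<bar> \<le> e / 2"
        using d[OF that] False by (simp add: abs_divide divide_le_eq)
      with \<open>e > 0\<close> show ?thesis
        by simp
    qed
    with \<open>d > 0\<close> show "\<exists>d>0. \<forall>s. s \<noteq> t \<and> norm (s - t) < d \<longrightarrow> norm (k s - g t) < e"
      by auto
  qed
  moreover have "((\<lambda>s. (a s - a t) / (s - t)) \<longlongrightarrow> deriv a t) (at t)"
    using has_deriv by (simp add: has_field_derivative_iff)
  ultimately have "((\<lambda>s. k s * ((a s - a t) / (s - t))) \<longlongrightarrow> g t * deriv a t) (at t)"
    by (rule tendsto_mult)
  then have "((\<lambda>s. (G s - G t) / (s - t)) \<longlongrightarrow> g t * deriv a t) (at t)"
    using G_eq by (rule Lim_transform_eventually)
  then show ?thesis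
    by (simp add: has_field_derivative_iff G_def)
qed

section \<open>Moments of the input\<close>

text \<open>Admitting every polynomial makes this linear in \<open>q\<close>, so that derivatives
  need to be computed for monomials only.\<close>

definition moment :: "(real \<Rightarrow> real) \<Rightarrow> real poly \<Rightarrow> real \<Rightarrow> real" where
  "moment u q t = (LINT s:{..t}|lborel. poly q (warp a t s) * (warp_density t s * u s))"

context
  fixes u :: "real \<Rightarrow> real"
  assumes int: "\<And>t. set_integrable lborel {..t} (\<lambda>s. warp_density t s * u s)"
begin

lemma moment_integrable: "set_integrable lborel {..t} (\<lambda>s. poly q (warp a t s) * (warp_density t s * u s))"
  using int by (rule integrable_poly_warp_mult)

lemma moment_0: "moment u 0 t = 0"
  by (simp add: moment_def)

lemma moment_add: "moment u (p + q) t = moment u p t + moment u q t"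
  unfolding moment_def by (simp add: distrib_right moment_integrable)

lemma moment_smult: "moment u (smult c p) t = c * moment u p t"
  unfolding moment_def by (simp add: mult.assoc)

lemma moment_sum: "moment u (\<Sum>i\<in>I. f i) t = (\<Sum>i\<in>I. moment u (f i) t)"
  by (induction I rule: infinite_finite_induct) (simp_all add: moment_0 moment_add)

text \<open>A power of the warp separates into a factor in \<open>s\<close> and a factor in
  \<open>t\<close>. The moment is therefore an exponential in \<open>a t\<close> times a running
  integral whose integrand is free of \<open>t\<close>.\<close>

lemma moment_monom_has_derivative:
  assumes u: "continuous_on UNIV u"
  shows "(moment u (monom 1 i) has_real_derivative
    deriv a t * (u t - (real i + 1) * moment u (monom 1 i) t)) (at t)"
proof -
  define g where "g = (\<lambda>s. exp ((real i + 1) * a s) * u s)"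
  define G where "G = (\<lambda>t. LINT s:{..t}|lborel. g s * deriv a s)"
  have eq: "g s * deriv a s = exp ((real i + 1) * a t) *
      (poly (monom 1 i) (warp a t s) * (warp_density t s * u s))" for s t
  proof -
    have "exp ((real i + 1) * a s) = exp ((real i + 1) * a t + real (Suc i) * (a s - a t))"
      by (simp add: algebra_simps)
    also have "\<dots> = exp ((real i + 1) * a t) * warp a t s ^ Suc i"
      by (simp only: exp_add exp_of_nat_mult warp_def)
    finally show ?thesis
      by (simp add: g_def warp_density_def poly_monom mult_ac)
  qed
  have "set_integrable lborel {..t} (\<lambda>s. g s * deriv a s)" for t
    unfolding eq[of _ t] by (intro set_integrable_mult_right moment_integrable)
  moreover have "isCont a t" "isCont u t"
    using u has_deriv by (auto simp: continuous_on_eq_continuous_at intro: DERIV_isCont)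
  then have "isCont g t"
    unfolding g_def by (intro continuous_intros)
  ultimately have G: "(G has_real_derivative g t * deriv a t) (at t)"
    unfolding G_def by (rule running_integral_has_derivative)
  have cancel: "exp (- x) * (exp x * y) = y" for x y :: real
    by (simp add: exp_minus)
  have moment_eq: "moment u (monom 1 i) t = exp (- ((real i + 1) * a t)) * G t" for t
    unfolding moment_def G_def eq[of _ t] by (simp only: set_integral_mult_right cancel)
  have exp_g: "exp (- ((real i + 1) * a t)) * g t = u t"
    unfolding g_def by (rule cancel)
  have "((\<lambda>t. exp (- ((real i + 1) * a t)) * G t) has_real_derivative
      exp (- ((real i + 1) * a t)) * (g t * deriv a t) -
      (real i + 1) * deriv a t * exp (- ((real i + 1) * a t)) * G t) (at t)"
    by (auto intro!: derivative_eq_intros has_deriv G simp: algebra_simps)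
  also have "exp (- ((real i + 1) * a t)) * (g t * deriv a t) -
      (real i + 1) * deriv a t * exp (- ((real i + 1) * a t)) * G t =
      deriv a t * (u t - (real i + 1) * moment u (monom 1 i) t)"
    unfolding moment_eq exp_g[symmetric] by (simp add: algebra_simps)
  finally show ?thesis
    unfolding moment_eq[abs_def] .
qed

text \<open>By linearity from the monomials, on which q \<mapsto> (y q)' is multiplication by
  \<open>i + 1\<close>; \<open>poly q 1\<close> is the sum of the coefficients.\<close>

lemma moment_has_derivative:
  assumes u: "continuous_on UNIV u"
  shows "(moment u q has_real_derivative
    deriv a t * (poly q 1 * u t - moment u (pderiv ([:0, 1:] * q)) t)) (at t)"
proof -
  have q: "q = (\<Sum>i\<le>degree q. smult (coeff q i) (monom 1 i))"
    by (simp add: smult_monom poly_as_sum_of_monoms)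
  have "pderiv ([:0, 1:] * monom 1 i) = smult (real i + 1) (monom 1 i)" for i
    by (simp add: monom_Suc[symmetric] pderiv_monom smult_monom add.commute)
  then have d: "pderiv ([:0, 1:] * q) = (\<Sum>i\<le>degree q. smult (coeff q i * (real i + 1)) (monom 1 i))"
    by (subst q) (simp add: sum_distrib_left higher_pderiv_sum[of 1, simplified] pderiv_smult
        del: mult_pCons_left)
  have p: "poly q 1 = (\<Sum>i\<le>degree q. coeff q i)"
    by (simp add: poly_altdef)
  have "((\<lambda>t. \<Sum>i\<le>degree q. coeff q i * moment u (monom 1 i) t) has_real_derivative
      (\<Sum>i\<le>degree q. coeff q i * (deriv a t * (u t - (real i + 1) * moment u (monom 1 i) t)))) (at t)"
    by (intro DERIV_sum DERIV_cmult moment_monom_has_derivative u)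
  also have "(\<lambda>t. \<Sum>i\<le>degree q. coeff q i * moment u (monom 1 i) t) = moment u q"
    by (subst (3) q) (simp add: moment_sum moment_smult fun_eq_iff)
  also have "(\<Sum>i\<le>degree q. coeff q i * (deriv a t * (u t - (real i + 1) * moment u (monom 1 i) t))) =
      deriv a t * (poly q 1 * u t - moment u (pderiv ([:0, 1:] * q)) t)"
    unfolding d p moment_sum moment_smult
    by (simp add: sum_distrib_left sum_distrib_right sum_subtractf[symmetric] algebra_simps)
  finally show ?thesis .
qed

end

text \<open>The substitution y = \<open>warp a t s\<close> in disguise:
  \<open>poly q (warp a t s)\<close> is an antiderivative of the integrand, with value
  \<open>poly q 1\<close> at \<open>t\<close> and limit \<open>poly q 0\<close> in the past.\<close>

lemma moment_1_pderiv: "moment (\<lambda>_. 1) (pderiv q) t = poly q 1 - poly q 0"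
proof -
  let ?f = "\<lambda>s. poly (pderiv q) (warp a t s) * (warp_density t s * 1)"
  have int: "set_integrable lborel {..t} ?f"
    using integrable_warp_density by (intro moment_integrable) simp
  have integral_lim: "((\<lambda>c. LINT s:{c..t}|lborel. ?f s) \<longlongrightarrow> moment (\<lambda>_. 1) (pderiv q) t) at_bot"
    unfolding moment_def by (rule tendsto_set_lebesgue_integral_at_bot[OF _ int]) simp
  have ftc: "\<forall>\<^sub>F c in at_bot. poly q 1 - poly q (warp a t c) = (LINT s:{c..t}|lborel. ?f s)"
    using eventually_le_at_bot[of t]
  proof eventually_elim
    case (elim c)
    \<comment> \<open>The gauge integral recovers any function from its derivative, continuous or
      not; \<open>int\<close> then identifies it with the Lebesgue integral.\<close>
    have "(?f has_integral poly q (warp a t t) - poly q (warp a t c)) {c..t}"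
    proof (rule fundamental_theorem_of_calculus[OF elim])
      fix s
      have "((\<lambda>s. poly q (warp a t s)) has_real_derivative ?f s) (at s)"
        using DERIV_chain2[OF poly_DERIV warp_has_deriv] by simp
      then show "((\<lambda>s. poly q (warp a t s)) has_vector_derivative ?f s) (at s within {c..t})"
        by (simp add: has_real_derivative_iff_has_vector_derivative has_vector_derivative_at_within)
    qed
    moreover have "set_integrable lborel {c..t} ?f"
      by (rule set_integrable_subset[OF int]) auto
    ultimately show ?case
      by (simp add: set_borel_integral_eq_integral(2) integral_unique)
  qed
  have "((\<lambda>c. poly q 1 - poly q (warp a t c)) \<longlongrightarrow> poly q 1 - poly q 0) at_bot"
    by (intro tendsto_intros warp_tendsto_0)
  from Lim_transform_eventually[OF this ftc] show ?thesis
    by (rule tendsto_unique[OF trivial_limit_at_bot_linorder integral_lim])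
qed

text \<open>The input vanishes up to \<open>t0\<close> and is bounded on the compact rest of
  \<open>{..t}\<close>, so a multiple of the density dominates.\<close>

lemma integrable_warp_density_mult_delayed:
  assumes u: "continuous_on UNIV u" and zero: "\<And>s. s \<le> t0 \<Longrightarrow> u s = 0"
  shows "set_integrable lborel {..t} (\<lambda>s. warp_density t s * u s)"
proof -
  have "bounded (u ` {t0..t})"
    by (intro compact_imp_bounded compact_continuous_image continuous_on_subset[OF u]) auto
  then obtain B where "B > 0" and B: "\<And>s. t0 \<le> s \<Longrightarrow> s \<le> t \<Longrightarrow> \<bar>u s\<bar> \<le> B"
    unfolding bounded_pos by auto
  have [measurable]: "u \<in> borel_measurable borel"
    using u by (rule borel_measurable_continuous_onI)
  have bound: "\<bar>u s\<bar> \<le> B" if "s \<le> t" for s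
    using B[of s] zero[of s] \<open>B > 0\<close> that by (cases "t0 \<le> s") auto
  show ?thesis
  proof (rule set_integrable_bound)
    show "set_integrable lborel {..t} (\<lambda>s. B * warp_density t s)"
      using integrable_warp_density by simp
    show "set_borel_measurable lborel {..t} (\<lambda>s. warp_density t s * u s)"
      unfolding set_borel_measurable_def by measurable
    show "AE s in lborel. s \<in> {..t} \<longrightarrow> norm (warp_density t s * u s) \<le> norm (B * warp_density t s)"
      using bound \<open>B > 0\<close> warp_density_nonneg
      by (auto simp: abs_mult mult.commute[of B] intro!: mult_left_mono)
  qed
qed

section \<open>Uniqueness for triangular systems\<close>

text \<open>Once the components below \<open>n\<close> vanish, the equation for \<open>z n\<close>
  is scalar, and the integrating factor \<open>exp (- (L n n * a t))\<close> turns
  \<open>z n\<close> into a constant.\<close>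

lemma lower_triangular_ode_zero:
  fixes n N :: nat
  assumes L: "\<And>n k. n < k \<Longrightarrow> L n k = 0"
    and z: "\<And>n t. n < N \<Longrightarrow> (z n has_real_derivative (\<Sum>k<N. deriv a t * L n k * z k t)) (at t)"
    and init: "\<And>n. n < N \<Longrightarrow> z n t0 = 0"
    and "n < N"
  shows "z n t = 0"
  using \<open>n < N\<close>
proof (induction n arbitrary: t rule: less_induct)
  case (less n)
  have "(\<Sum>k<N. deriv a t * L n k * z k t) = deriv a t * L n n * z n t" for t
  proof -
    have "(\<Sum>k<N. deriv a t * L n k * z k t) = (\<Sum>k\<in>{n}. deriv a t * L n k * z k t)"
      using less L by (intro sum.mono_neutral_right) (auto simp: neq_iff)
    then show ?thesis by simp
  qed
  then have z_n: "(z n has_real_derivative deriv a t * L n n * z n t) (at t)" for t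
    using z[OF less.prems, of t] by simp
  have "((\<lambda>t. exp (- (L n n * a t)) * z n t) has_real_derivative 0) (at t)" for t
    by (rule derivative_eq_intros z_n has_deriv refl)+ (simp add: algebra_simps)
  then have "exp (- (L n n * a t)) * z n t = exp (- (L n n * a t0)) * z n t0"
    using DERIV_isconst_all by blast
  then show ?case
    using init[OF less.prems] by simp
qed

section \<open>The Legendre system\<close>

abbreviation legs_weight :: "real \<Rightarrow> real \<Rightarrow> real" where
  "legs_weight t s \<equiv> indicator {0..1} (warp a t s) * deriv a s * warp a t s"

lemma legs_weight_eq_warp_density: "s \<le> t \<Longrightarrow> legs_weight t s = warp_density t s"
  using warp_pos[of t s] warp_le_1[of s t] by (simp add: warp_density_def)

lemma legs_weight_nonneg: "0 \<le> legs_weight t s"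
  using deriv_a_nonneg warp_pos[of t s] by (simp add: less_imp_le)

definition legs_state :: "(real \<Rightarrow> real) \<Rightarrow> nat \<Rightarrow> real \<Rightarrow> real" where
  "legs_state u n t = sqrt (2 * real n + 1) * moment u (shifted_legendre n) t"

text \<open>Stated for every \<open>u\<close>, so that it can rewrite the integrals of
  \<open>is_ossm\<close> before convergence is known.\<close>

lemma legs_integral_eq_state:
  "(LINT s:{..t}|lborel. legendre01 n (warp a t s) * legs_weight t s * u s) = legs_state u n t"
proof -
  have "(LINT s:{..t}|lborel. legendre01 n (warp a t s) * legs_weight t s * u s) =
      (LINT s:{..t}|lborel. sqrt (2 * real n + 1) *
        (poly (shifted_legendre n) (warp a t s) * (warp_density t s * u s)))"
    by (intro set_lebesgue_integral_cong) (auto simp: legs_weight_eq_warp_density legendre01_conv)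
  then show ?thesis
    by (simp add: legs_state_def moment_def)
qed

lemma legs_integrable:
  assumes "\<And>t. set_integrable lborel {..t} (\<lambda>s. warp_density t s * u s)"
  shows "set_integrable lborel {..t} (\<lambda>s. legendre01 n (warp a t s) * legs_weight t s * u s)"
proof -
  have "set_integrable lborel {..t} (\<lambda>s. sqrt (2 * real n + 1) *
      (poly (shifted_legendre n) (warp a t s) * (warp_density t s * u s)))"
    by (intro set_integrable_mult_right moment_integrable assms)
  then show ?thesis
    by (rule set_integrable_cong[THEN iffD1, rotated 3])
      (auto simp: legs_weight_eq_warp_density legendre01_conv)
qed

lemma legs_orthonormal:
  shows "set_integrable lborel {..t}
      (\<lambda>s. legendre01 n (warp a t s) * legendre01 m (warp a t s) * legs_weight t s)" (is "?int")
    and "(LINT s:{..t}|lborel. legendre01 n (warp a t s) * legendre01 m (warp a t s) * legs_weight t s) =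
      (if n = m then 1 else 0)" (is "?eq")
proof -
  let ?c = "sqrt (2 * real n + 1) * sqrt (2 * real m + 1)"
  let ?q = "shifted_legendre n * shifted_legendre m"
  have d: "set_integrable lborel {..t} (\<lambda>s. warp_density t s * 1)" for t
    using integrable_warp_density by simp
  have eq: "?c * (poly ?q (warp a t s) * (warp_density t s * 1)) =
      legendre01 n (warp a t s) * legendre01 m (warp a t s) * legs_weight t s" if "s \<in> {..t}" for s
    using that by (simp add: legs_weight_eq_warp_density legendre01_conv)
  have "set_integrable lborel {..t} (\<lambda>s. ?c * (poly ?q (warp a t s) * (warp_density t s * 1)))"
    by (intro set_integrable_mult_right moment_integrable d)
  then show ?int
    by (rule set_integrable_cong[THEN iffD1, rotated 3]) (use eq in auto)
  have "(LINT s:{..t}|lborel. legendre01 n (warp a t s) * legendre01 m (warp a t s) * legs_weight t s) =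
      (LINT s:{..t}|lborel. ?c * (poly ?q (warp a t s) * (warp_density t s * 1)))"
    by (rule set_lebesgue_integral_cong) (use eq in auto)
  also have "\<dots> = ?c * moment (\<lambda>_. 1) ?q t"
    unfolding moment_def by (rule set_integral_mult_right)
  \<comment> \<open>The moment with constant input 1 is the functional \<open>J\<close> of the
    orthogonality lemma; the square roots in \<open>?c\<close> then normalise the diagonal
    value.\<close>
  also have "moment (\<lambda>_. 1) ?q t = (if n = m then 1 / (2 * real n + 1) else 0)"
    by (rule shifted_legendre_orthogonal)
      (simp_all only: moment_add[OF d] moment_smult[OF d] moment_1_pderiv)
  finally show ?eq
    by simp
qed

lemma legs_state_solution:
  assumes int: "\<And>t. set_integrable lborel {..t} (\<lambda>s. warp_density t s * u s)"
    and u: "continuous_on UNIV u"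
  shows "ssm_solution N (\<lambda>t n k. deriv a t * legs_A n k) (\<lambda>t n. deriv a t * legs_B n) u (legs_state u)"
  unfolding ssm_solution_def
proof (intro allI impI)
  fix t n
  assume "n < N"
  let ?S = "shifted_legendre" and ?c = "\<lambda>n. sqrt (2 * real n + 1)"
  have "moment u (pderiv ([:0, 1:] * ?S n)) t =
      (real n + 1) * moment u (?S n) t + (\<Sum>k<n. (2 * real k + 1) * moment u (?S k) t)"
    unfolding pderiv_X_mult_shifted_legendre
    by (simp only: moment_add[OF int] moment_sum[OF int] moment_smult[OF int])
  \<comment> \<open>One square root of \<open>2k + 1\<close> belongs to the state, the other to the
    matrix entry.\<close>
  moreover have "(2 * real k + 1) * moment u (?S k) t = ?c k * legs_state u k t" for k
    by (simp add: legs_state_def)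
  ultimately have rec: "?c n * moment u (pderiv ([:0, 1:] * ?S n)) t =
      - (\<Sum>k<N. legs_A n k * legs_state u k t)"
    unfolding legs_A_sum[OF \<open>n < N\<close>] by (simp add: legs_state_def algebra_simps)
  have "(legs_state u n has_real_derivative
      ?c n * (deriv a t * (poly (?S n) 1 * u t - moment u (pderiv ([:0, 1:] * ?S n)) t))) (at t)"
    unfolding legs_state_def by (intro DERIV_cmult moment_has_derivative int u)
  also have "?c n * (deriv a t * (poly (?S n) 1 * u t - moment u (pderiv ([:0, 1:] * ?S n)) t)) =
      deriv a t * (?c n * u t - ?c n * moment u (pderiv ([:0, 1:] * ?S n)) t)"
    by (simp add: shifted_legendre_at_1 algebra_simps)
  also have "\<dots> = (\<Sum>k<N. deriv a t * legs_A n k * legs_state u k t) + deriv a t * legs_B n * u t"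
    unfolding rec by (simp add: legs_B_def sum_distrib_left algebra_simps)
  finally show "(legs_state u n has_real_derivative
      (\<Sum>k<N. deriv a t * legs_A n k * legs_state u k t) + deriv a t * legs_B n * u t) (at t)" .
qed

text \<open>The difference of the two states solves the homogeneous system and vanishes at
  \<open>t0\<close>, since \<open>u\<close> is zero throughout \<open>{..t0}\<close>.\<close>

lemma legs_state_unique:
  assumes u: "continuous_on UNIV u" and zero: "\<And>s. s \<le> t0 \<Longrightarrow> u s = 0"
    and x: "ssm_solution N (\<lambda>t n k. deriv a t * legs_A n k) (\<lambda>t n. deriv a t * legs_B n) u x"
    and init: "\<And>n. n < N \<Longrightarrow> x n t0 = 0"
    and "n < N"
  shows "x n t = legs_state u n t"
proof -
  have int: "set_integrable lborel {..t} (\<lambda>s. warp_density t s * u s)" for t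
    using u zero by (rule integrable_warp_density_mult_delayed)
  define z where "z = (\<lambda>n t. x n t - legs_state u n t)"
  have "z n t = 0"
  proof (rule lower_triangular_ode_zero[where L=legs_A and N=N and z=z and ?t0.0=t0])
    show "legs_A n k = 0" if "n < k" for n k
      using that by (simp add: legs_A_def)
    show "(z n has_real_derivative (\<Sum>k<N. deriv a t * legs_A n k * z k t)) (at t)" if "n < N" for n t
    proof -
      have "(z n has_real_derivative
          ((\<Sum>k<N. deriv a t * legs_A n k * x k t) + deriv a t * legs_B n * u t) -
          ((\<Sum>k<N. deriv a t * legs_A n k * legs_state u k t) + deriv a t * legs_B n * u t)) (at t)"
        unfolding z_def using x legs_state_solution[OF int u, of N] that
        by (intro DERIV_diff) (auto simp: ssm_solution_def)
      then show ?thesis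
        by (simp add: z_def right_diff_distrib sum_subtractf)
    qed
    show "z n t0 = 0" if "n < N" for n
    proof -
      have "moment u q t0 = (LINT s:{..t0}|lborel. 0)" for q
        unfolding moment_def by (intro set_lebesgue_integral_cong) (auto simp: zero)
      then show ?thesis
        using init[OF that] by (simp add: z_def legs_state_def)
    qed
  qed fact
  then show ?thesis
    by (simp add: z_def)
qed

end

theorem corollary3p1:
  fixes a :: "real \<Rightarrow> real" and N :: nat
  assumes diff: "a differentiable_on UNIV"
    and incr: "mono a"
    and past: "filterlim a at_bot at_bot"
  shows "is_ossm N
    (\<lambda>t n k. deriv a t * legs_A n k)
    (\<lambda>t n. deriv a t * legs_B n)
    (\<lambda>n t s. legendre01 n (warp a t s))
    (\<lambda>t s. indicator {0..1} (warp a t s) * deriv a s * warp a t s)"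
proof -
  interpret time_warp a
    using assms by unfold_locales
  have solution: "ssm_solution N (\<lambda>t n k. deriv a t * legs_A n k) (\<lambda>t n. deriv a t * legs_B n) u (legs_state u)"
    if u: "continuous_on UNIV u"
      and int: "\<And>t n. n < N \<Longrightarrow>
        set_integrable lborel {..t} (\<lambda>s. legendre01 n (warp a t s) * legs_weight t s * u s)" for u
  \<comment> \<open>With no components, nothing is to be shown. Otherwise component 0, whose
    polynomial is the constant 1, yields the integrability of the bare density times
    \<open>u\<close>.\<close>
  proof (cases "N = 0")
    case True
    then show ?thesis
      by (simp add: ssm_solution_def)
  next
    case False
    have "set_integrable lborel {..t} (\<lambda>s. warp_density t s * u s)" for t
    proof -
      have "set_integrable lborel {..t} (\<lambda>s. legendre01 0 (warp a t s) * legs_weight t s * u s)"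
        using int False by simp
      then show ?thesis
        by (rule set_integrable_cong[THEN iffD1, rotated 3])
          (auto simp: legs_weight_eq_warp_density legendre01_def legendre_0)
    qed
    then show ?thesis
      using u by (rule legs_state_solution)
  qed
  show ?thesis
    unfolding is_ossm_def legs_integral_eq_state
  proof (intro conjI allI impI)
    fix t s
    show "0 \<le> legs_weight t s"
      by (rule legs_weight_nonneg)
  next
    fix t n m
    show "set_integrable lborel {..t}
        (\<lambda>s. legendre01 n (warp a t s) * legendre01 m (warp a t s) * legs_weight t s)"
      and "(LINT s:{..t}|lborel. legendre01 n (warp a t s) * legendre01 m (warp a t s) * legs_weight t s) =
        (if n = m then 1 else 0)"
      by (rule legs_orthonormal)+
  next
    fix u :: "real \<Rightarrow> real"
    assume "continuous_on UNIV u" "\<forall>t. \<forall>n<N. set_integrable lborel {..t}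
        (\<lambda>s. legendre01 n (warp a t s) * legs_weight t s * u s)"
    then show "ssm_solution N (\<lambda>t n k. deriv a t * legs_A n k) (\<lambda>t n. deriv a t * legs_B n) u
        (\<lambda>n t. legs_state u n t)"
      using solution by simp
  next
    fix u :: "real \<Rightarrow> real" and t0 t n
    assume "continuous_on UNIV u" "\<forall>t\<le>t0. u t = 0"
    then show "set_integrable lborel {..t} (\<lambda>s. legendre01 n (warp a t s) * legs_weight t s * u s)"
      using integrable_warp_density_mult_delayed by (intro legs_integrable) blast
  next
    fix u :: "real \<Rightarrow> real" and t0 x t n
    assume "continuous_on UNIV u" "\<forall>t\<le>t0. u t = 0" "n < N" "\<forall>t\<le>t0. \<forall>n<N. x n t = 0"
      "ssm_solution N (\<lambda>t n k. deriv a t * legs_A n k) (\<lambda>t n. deriv a t * legs_B n) u x"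
    then show "x n t = legs_state u n t"
      by (intro legs_state_unique) auto
  qed
qed

end
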